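(* The subtractive closure operator $\operatorname{scl}_{\mathbb{N}_0}$ on the standard semiring $\mathbb{N}_0$ of nonnegative integers (with usual addition and multiplication) distributes over the multiplication of ideals, i.e., for any ideals $I$ and $J$ of $\mathbb{N}_0$, \[ \operatorname{scl}_{\mathbb{N}_0}(I)\operatorname{scl}_{\mathbb{N}_0}(J) = \operatorname{scl}_{\mathbb{N}_0}(IJ). \]
   Context: An ideal of $\mathbb{N}_0$ is a nonempty subset $I$ with $a+b\in I$ and $na\in I$ for all $a,b\in I$, $n\in \mathbb{N}_0$. An ideal $I$ is subtractive if $x+y\in I$ and $x\in I$ imply $y\in I$, for all $x,y\in\mathbb{N}_0$. $\operatorname{scl}_{\mathbb{N}_0}(I)$ is the intersection of all subtractive ideals of $\mathbb{N}_0$ containing $I$. $IJ$ is the set of all finite sums of products $ij$ with $i\in I$, $j\in J$. *)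

theory Defs
  imports Main
begin

definition nat_ideal :: "nat set \<Rightarrow> bool" where
  "nat_ideal I \<longleftrightarrow>
     I \<noteq> {} \<and> (\<forall>a\<in>I. \<forall>b\<in>I. a + b \<in> I) \<and> (\<forall>a\<in>I. \<forall>n. n * a \<in> I)"

definition subtractive_ideal :: "nat set \<Rightarrow> bool" where
  "subtractive_ideal I \<longleftrightarrow>
     nat_ideal I \<and> (\<forall>x y. x + y \<in> I \<and> x \<in> I \<longrightarrow> y \<in> I)"

definition scl :: "nat set \<Rightarrow> nat set" where
  "scl I = \<Inter> {K. subtractive_ideal K \<and> I \<subseteq> K}"

(* The empty sum (n = 0) is allowed; this is harmless, since every ideal contains 0. *)
definition ideal_mult :: "nat set \<Rightarrow> nat set \<Rightarrow> nat set" where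
  "ideal_mult I J =
     {(\<Sum>k<n. f k * g k) | (n :: nat) f g. \<forall>k<n. f k \<in> I \<and> g k \<in> J}"

end

(* Division with remainder shows that a subtractive ideal of the naturals consists of all multiples
   of a single number. Hence scl I is the set of multiples of Gcd I, and the theorem reduces to
   Gcd (I J) = Gcd I * Gcd J. *)
theory Submission
  imports Defs
begin

lemma subtractive_ideal_multiples: "subtractive_ideal {n. d dvd n}" for d :: nat
  unfolding subtractive_ideal_def nat_ideal_def
  by (auto simp: dvd_add_right_iff intro!: exI[of _ 0])

lemma subtractive_ideal_eq_multiples_Gcd:
  assumes "subtractive_ideal K"
  shows "K = {n. Gcd K dvd n}"
proof -
  have mult: "n * a \<in> K" if "a \<in> K" for a n
    using assms that unfolding subtractive_ideal_def nat_ideal_def by blast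
  have sub: "y \<in> K" if "x + y \<in> K" "x \<in> K" for x y
    using assms that unfolding subtractive_ideal_def by blast
  \<comment> \<open>A common divisor of \<open>K\<close> that lies in \<open>K\<close> settles
    everything: it equals \<open>Gcd K\<close>, and \<open>mult\<close> puts all its multiples into
    \<open>K\<close>.\<close>
  obtain d where d: "d \<in> K" and d_dvd: "\<And>x. x \<in> K \<Longrightarrow> d dvd x"
  proof (cases "\<exists>x\<in>K. x > 0")
    case True
    define d where "d = (LEAST x. x \<in> K \<and> x > 0)"
    have d: "d \<in> K" "d > 0"
      using LeastI_ex[of "\<lambda>x. x \<in> K \<and> x > 0"] True by (auto simp: d_def)
    have "d dvd x" if "x \<in> K" for x
    proof -
      \<comment> \<open>The left summand is in \<open>K\<close> by \<open>mult\<close>, so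
        subtractivity puts the remainder into \<open>K\<close>; minimality of \<open>d\<close> then
        forces it to be 0.\<close>
      have "x div d * d + x mod d \<in> K" using that by simp
      then have "x mod d \<in> K" using sub mult d(1) by blast
      moreover have "x mod d < d" using d(2) by simp
      ultimately have "x mod d = 0"
        using not_less_Least[of "x mod d" "\<lambda>x. x \<in> K \<and> x > 0"] by (auto simp: d_def)
      then show ?thesis by auto
    qed
    with d(1) show ?thesis by (rule that)
  next
    case False
    moreover have "K \<noteq> {}"
      using assms by (auto simp: subtractive_ideal_def nat_ideal_def)
    \<comment> \<open>Here \<open>K\<close> contains only 0, and 0 divides itself.\<close>
    ultimately show ?thesis by (intro that[of 0]) auto
  qed
  have "Gcd K = d"
    by (rule dvd_antisym) (simp_all add: Gcd_dvd Gcd_greatest d d_dvd)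
  moreover have "n \<in> K" if "d dvd n" for n
    using that mult[OF d] by (auto simp: dvd_def mult.commute)
  ultimately show ?thesis using d_dvd by auto
qed

text \<open>The multiples of \<open>Gcd I\<close> form one of the ideals being intersected. Any
  other such \<open>K\<close> consists of the multiples of \<open>Gcd K\<close>, which divides
  \<open>Gcd I\<close> because \<open>I\<close> lies in \<open>K\<close>.\<close>

lemma scl_eq_multiples_Gcd: "scl I = {n. Gcd I dvd n}"
proof
  show "scl I \<subseteq> {n. Gcd I dvd n}"
    unfolding scl_def by (rule Inter_lower) (auto simp: subtractive_ideal_multiples)
next
  show "{n. Gcd I dvd n} \<subseteq> scl I"
    unfolding scl_def
  proof (rule Inter_greatest)
    fix K assume "K \<in> {K. subtractive_ideal K \<and> I \<subseteq> K}"
    then have "subtractive_ideal K" and "I \<subseteq> K" by auto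
    note K = subtractive_ideal_eq_multiples_Gcd[OF this(1)]
    have "Gcd K dvd Gcd I"
      using \<open>I \<subseteq> K\<close> by (intro Gcd_greatest Gcd_dvd) auto
    then show "{n. Gcd I dvd n} \<subseteq> K"
      by (subst K) (use dvd_trans in blast)
  qed
qed

lemma mult_in_ideal_mult:
  assumes "i \<in> I" and "j \<in> J"
  shows "i * j \<in> ideal_mult I J"
  unfolding ideal_mult_def
  by (rule CollectI, rule exI[of _ 1], rule exI[of _ "\<lambda>_. i"], rule exI[of _ "\<lambda>_. j"])
    (use assms in auto)

lemma dvd_ideal_mult:
  assumes "\<And>i. i \<in> I \<Longrightarrow> a dvd i" and "\<And>j. j \<in> J \<Longrightarrow> b dvd j" and "x \<in> ideal_mult I J"
  shows "a * b dvd x"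
  using assms unfolding ideal_mult_def by (auto intro!: dvd_sum mult_dvd_mono)

text \<open>One divisibility holds term by term in the sums. The other looks only at single products
  \<open>i * j\<close> and pulls out one factor at a time.\<close>

lemma Gcd_ideal_mult: "Gcd (ideal_mult I J) = Gcd I * Gcd J"
proof (rule dvd_antisym)
  show "Gcd I * Gcd J dvd Gcd (ideal_mult I J)"
    by (rule Gcd_greatest, rule dvd_ideal_mult[of I _ J]) (simp_all add: Gcd_dvd)
next
  let ?g = "Gcd (ideal_mult I J)"
  have "?g dvd i * Gcd J" if "i \<in> I" for i
  proof -
    \<comment> \<open>With \<open>i\<close> fixed and \<open>j\<close> ranging over
      \<open>J\<close>, \<open>Gcd_mult\<close> turns this Gcd into
      \<open>i * Gcd J\<close>.\<close>
    have "?g dvd Gcd ((*) i ` J)"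
      using that by (intro Gcd_greatest) (auto intro: Gcd_dvd mult_in_ideal_mult)
    then show ?thesis by (simp add: Gcd_mult)
  qed
  \<comment> \<open>The same extraction again, now with \<open>Gcd J\<close> fixed and
    \<open>i\<close> ranging over \<open>I\<close>.\<close>
  then have "?g dvd Gcd ((*) (Gcd J) ` I)"
    by (intro Gcd_greatest) (auto simp: mult.commute)
  then show "?g dvd Gcd I * Gcd J" by (simp add: Gcd_mult mult.commute[of "Gcd I"])
qed

lemma ideal_mult_multiples: "ideal_mult {n. a dvd n} {n. b dvd n} = {n. a * b dvd n}"
proof
  show "ideal_mult {n. a dvd n} {n. b dvd n} \<subseteq> {n. a * b dvd n}"
    using dvd_ideal_mult[of "{n. a dvd n}" a "{n. b dvd n}" b] by blast
next
  show "{n. a * b dvd n} \<subseteq> ideal_mult {n. a dvd n} {n. b dvd n}"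
  proof
    fix n assume "n \<in> {n. a * b dvd n}"
    \<comment> \<open>Grouping the cofactor \<open>k\<close> with \<open>b\<close> exhibits
      \<open>n\<close> as a single product of a multiple of \<open>a\<close> and a multiple of
      \<open>b\<close>.\<close>
    then obtain k where "n = a * (b * k)" by (auto simp: dvd_def mult.assoc)
    then show "n \<in> ideal_mult {n. a dvd n} {n. b dvd n}"
      by (auto intro: mult_in_ideal_mult)
  qed
qed

theorem theorem5p8:
  fixes I J :: "nat set"
  assumes "nat_ideal I" and "nat_ideal J"
  shows "ideal_mult (scl I) (scl J) = scl (ideal_mult I J)"
  by (simp add: scl_eq_multiples_Gcd ideal_mult_multiples Gcd_ideal_mult)

end
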